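(* Let $G=(V,E)$ be a simple finite graph on $m$ vertices $v_1,\ldots,v_m$, and let $\mathbf{f}=(f_1,\ldots,f_m)\in\mathbb{N}^m$ be an ordered $m$-tuple of distinct positive integers. Let $\Lambda_{\mathbf{f}}=\Delta_{\mathbf{f}}-\Psi$ be the associated $\mathbf{f}$-labeled zeon combinatorial Laplacian of $G$. Then, for each $\ell=1,\ldots,m$, $\Lambda_{\mathbf{f}}$ has a spectrally simple eigenvalue $\lambda_\ell$ satisfying $$\lambda_\ell=f_\ell+\sum_{I\subseteq[m]}\omega_I\,\zeta_I\prod_{j\in I\setminus\{\ell\}}(f_\ell-f_j)^{-1},$$ where $(-1)^{|I|}\omega_I$ is the number of cycles based at $v_\ell$ on vertices indexed by $I$.
   Context: Zeon algebra: $\mathbb{C}\mathfrak{Z}$ is the commutative unital complex algebra generated by $\zeta_{\{i\}}$, $i\in\mathbb{N}=\{1,2,\ldots\}$, and the scalar $1=\zeta_\varnothing$, with $\zeta_{\{i\}}\zeta_{\{j\}}=\zeta_{\{j\}}\zeta_{\{i\}}=\zeta_{\{i,j\}}$ for $i\neq j$ and $\zeta_{\{i\}}^2=0$. For finite $I\subset\mathbb{N}$, $\zeta_I=\prod_{i\in I}\zeta_{\{i\}}$; the $\zeta_I$ form a vector space basis. For $u=\sum_I u_I\zeta_I$, the scalar part is $\mathfrak{C}u=u_\varnothing$. Eigenvalues: for $A\in\mathrm{Mat}(m,\mathbb{C}\mathfrak{Z})$, $\lambda\in\mathbb{C}\mathfrak{Z}$ is an eigenvalue if $A\xi=\lambda\xi$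 for some non-null $\xi\in\mathbb{C}\mathfrak{Z}^m$ (non-null: $\mathfrak{C}(\overline{\xi}^{\intercal}\xi)\ne 0$, where the bar is complex conjugation of coefficients; equivalently some component of $\xi$ has nonzero scalar part). The characteristic polynomial is $\chi_A(t)=\det(t\mathbb{I}-A)$. An eigenvalue $\lambda$ is spectrally simple if it is a simple zero of $\chi_A$ (i.e. $\chi_A(u)=(u-\lambda)g(u)$ with $g(\lambda)\neq 0$ for a polynomial $g$ over $\mathbb{C}\mathfrak{Z}$) and $\mathfrak{C}\lambda$ is a simple zero of the complex polynomial obtained by taking scalar parts of the coefficients of $\chi_A$. Graphs: $[m]=\{1,\ldots,m\}$. The nilpotent adjacency matrix $\Psi=(\psi_{ij})$ of $G$ has $\psi_{ij}=\zeta_{\{j\}}$ if $\{v_i,v_j\}\in E$ and $\psi_{ij}=0$ otherwise. $\Delta_{\mathbf{f}}$ is the $m\times m$ diagonal matrix with main diagonal $\mathbf{f}$. Cycles: a $k$-cycle based at $v$ is a sequence of vertices $(w_0,w_1,\ldots,w_k)$ with $w_0=w_k=v$, consecutive vertices adjacent, and $w_0,\ldots,w_{k-1}$ distinct. Cycles are counted as sequences, so 2-cycles $(v,w,v)$ along an edge are counted and the two orientations of a longer cycle are counted separately. The cycle is on vertices indexed by $I$ if $\{w_0,\ldots,w_{k-1}\}=\{v_i:i\in I\}$. *)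

theory Defs
  imports "Jordan_Normal_Form.Char_Poly"
begin

section \<open>The zeon algebra over the complex numbers\<close>

text \<open>
  An element is represented by its family of coefficients \<open>I \<mapsto> u\<^sub>I\<close>: finitely many of
  them are nonzero, and only at finite sets of positive integers.
\<close>

typedef zeon =
  "{u :: nat set \<Rightarrow> complex. finite {I. u I \<noteq> 0} \<and> (\<forall>I. u I \<noteq> 0 \<longrightarrow> finite I \<and> 0 \<notin> I)}"
  morphisms zcoeff Abs_zeon
  by (rule exI[of _ "\<lambda>_. 0"]) auto

setup_lifting type_definition_zeon

lemma zeon_eqI: "(\<And>I. finite I \<Longrightarrow> 0 \<notin> I \<Longrightarrow> zcoeff u I = zcoeff v I) \<Longrightarrow> u = v"
  by transfer (rule ext, metis)

lemma finite_zcoeff_support: "finite {I. zcoeff u I \<noteq> 0}"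
  by transfer blast

lemma zcoeff_nonzeroD: "zcoeff u I \<noteq> 0 \<Longrightarrow> finite I" "zcoeff u I \<noteq> 0 \<Longrightarrow> 0 \<notin> I"
  by (transfer, blast)+

lemma zeon_sum_nonzeroD:
  fixes u v :: "nat set \<Rightarrow> complex"
  assumes "(\<Sum>J\<in>Pow I. u J * v (I - J)) \<noteq> 0"
  obtains J where "J \<subseteq> I" "u J \<noteq> 0" "v (I - J) \<noteq> 0"
proof -
  obtain J where "J \<in> Pow I" "u J * v (I - J) \<noteq> 0"
    using assms by (meson sum.neutral)
  then show thesis using that by auto
qed

lemma zeon_assoc_aux:
  fixes u v w :: "nat set \<Rightarrow> complex"
  assumes "finite I"
  shows "(\<Sum>J\<in>Pow I. (\<Sum>K\<in>Pow J. u K * v (J - K)) * w (I - J)) =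
         (\<Sum>K\<in>Pow I. u K * (\<Sum>L\<in>Pow (I - K). v L * w ((I - K) - L)))"
proof -
  have fin: "finite J" if "J \<in> Pow I" for J using that assms finite_subset by auto
  have "(\<Sum>J\<in>Pow I. (\<Sum>K\<in>Pow J. u K * v (J - K)) * w (I - J)) =
        (\<Sum>(J, K)\<in>(SIGMA J:Pow I. Pow J). u K * v (J - K) * w (I - J))"
    using fin assms by (simp add: sum.Sigma sum_distrib_right)
  also have "\<dots> = (\<Sum>(K, L)\<in>(SIGMA K:Pow I. Pow (I - K)). u K * (v L * w ((I - K) - L)))"
  proof (rule sum.reindex_bij_witness[of _ "\<lambda>(K, L). (K \<union> L, K)" "\<lambda>(J, K). (K, J - K)"])
    fix a assume a: "a \<in> (SIGMA J:Pow I. Pow J)"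
    obtain J K where [simp]: "a = (J, K)" by (cases a)
    have "I - K - (J - K) = I - J" using a by auto
    then show "(case case a of (J, K) \<Rightarrow> (K, J - K) of
                (K, L) \<Rightarrow> u K * (v L * w (I - K - L))) =
               (case a of (J, K) \<Rightarrow> u K * v (J - K) * w (I - J))" by simp
  qed auto
  also have "\<dots> = (\<Sum>K\<in>Pow I. u K * (\<Sum>L\<in>Pow (I - K). v L * w ((I - K) - L)))"
    using assms by (simp add: sum.Sigma sum_distrib_left)
  finally show ?thesis .
qed

lemma zeon_comm_aux:
  fixes u v :: "nat set \<Rightarrow> complex"
  shows "(\<Sum>J\<in>Pow I. u J * v (I - J)) = (\<Sum>J\<in>Pow I. v J * u (I - J))"
  by (rule sum.reindex_bij_witness[of _ "\<lambda>J. I - J" "\<lambda>J. I - J"]) (auto simp: double_diff)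

instantiation zeon :: comm_ring_1
begin

lift_definition zero_zeon :: zeon is "\<lambda>_. 0" by simp

lift_definition one_zeon :: zeon is "\<lambda>I. if I = {} then 1 else 0" by simp

lift_definition plus_zeon :: "zeon \<Rightarrow> zeon \<Rightarrow> zeon" is "\<lambda>u v I. u I + v I"
proof -
  fix u v :: "nat set \<Rightarrow> complex"
  assume u: "finite {I. u I \<noteq> 0} \<and> (\<forall>I. u I \<noteq> 0 \<longrightarrow> finite I \<and> 0 \<notin> I)"
    and v: "finite {I. v I \<noteq> 0} \<and> (\<forall>I. v I \<noteq> 0 \<longrightarrow> finite I \<and> 0 \<notin> I)"
  have "{I. u I + v I \<noteq> 0} \<subseteq> {I. u I \<noteq> 0} \<union> {I. v I \<noteq> 0}" by auto
  then have "finite {I. u I + v I \<noteq> 0}" using u v by (meson finite_Un finite_subset)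
  moreover have "\<forall>I. u I + v I \<noteq> 0 \<longrightarrow> finite I \<and> 0 \<notin> I" using u v by (metis add_0)
  ultimately show "finite {I. u I + v I \<noteq> 0} \<and> (\<forall>I. u I + v I \<noteq> 0 \<longrightarrow> finite I \<and> 0 \<notin> I)" ..
qed

lift_definition uminus_zeon :: "zeon \<Rightarrow> zeon" is "\<lambda>u I. - u I" by simp

definition minus_zeon :: "zeon \<Rightarrow> zeon \<Rightarrow> zeon" where "minus_zeon u v = u + - v"

text \<open>
  Since \<open>\<zeta>\<^sub>J \<zeta>\<^sub>K\<close> is \<open>\<zeta>\<close> of the union when \<open>J\<close> and \<open>K\<close> are disjoint and \<open>0\<close> otherwise, the
  coefficient of a product at \<open>I\<close> is a sum over the splittings of \<open>I\<close> into two disjoint parts.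
\<close>

lift_definition times_zeon :: "zeon \<Rightarrow> zeon \<Rightarrow> zeon"
  is "\<lambda>u v I. \<Sum>J\<in>Pow I. u J * v (I - J)"
proof -
  fix u v :: "nat set \<Rightarrow> complex"
  assume u: "finite {I. u I \<noteq> 0} \<and> (\<forall>I. u I \<noteq> 0 \<longrightarrow> finite I \<and> 0 \<notin> I)"
    and v: "finite {I. v I \<noteq> 0} \<and> (\<forall>I. v I \<noteq> 0 \<longrightarrow> finite I \<and> 0 \<notin> I)"
  let ?w = "\<lambda>I. \<Sum>J\<in>Pow I. u J * v (I - J)"
  have *: "\<exists>J. J \<subseteq> I \<and> u J \<noteq> 0 \<and> v (I - J) \<noteq> 0" if "?w I \<noteq> 0" for I
    using that by (rule zeon_sum_nonzeroD) auto
  have "{I. ?w I \<noteq> 0} \<subseteq> (\<lambda>(J, K). J \<union> K) ` ({I. u I \<noteq> 0} \<times> {I. v I \<noteq> 0})"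
  proof
    fix I assume "I \<in> {I. ?w I \<noteq> 0}"
    then obtain J where "J \<subseteq> I" "u J \<noteq> 0" "v (I - J) \<noteq> 0" using * by blast
    then show "I \<in> (\<lambda>(J, K). J \<union> K) ` ({I. u I \<noteq> 0} \<times> {I. v I \<noteq> 0})"
      by (intro image_eqI[of _ _ "(J, I - J)"]) auto
  qed
  then have "finite {I. ?w I \<noteq> 0}" using u v by (meson finite_SigmaI finite_imageI finite_subset)
  moreover have "finite I \<and> 0 \<notin> I" if I: "?w I \<noteq> 0" for I
  proof -
    obtain J where J: "J \<subseteq> I" "u J \<noteq> 0" "v (I - J) \<noteq> 0" using *[OF I] by blast
    then have "finite J" "0 \<notin> J" "finite (I - J)" "0 \<notin> I - J" using u v by blast+
    then show ?thesis using J(1) by (auto dest: finite_Diff2)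
  qed
  ultimately show "finite {I. ?w I \<noteq> 0} \<and> (\<forall>I. ?w I \<noteq> 0 \<longrightarrow> finite I \<and> 0 \<notin> I)" by blast
qed

instance
proof
  fix a b c :: zeon
  show "a + b + c = a + (b + c)" by transfer (simp add: add.assoc)
  show "a + b = b + a" by transfer (simp add: add.commute)
  show "0 + a = a" by transfer simp
  show "- a + a = 0" by transfer simp
  show "a - b = a + - b" by (simp add: minus_zeon_def)
  show "a * b * c = a * (b * c)"
    by (rule zeon_eqI, transfer) (rule zeon_assoc_aux)
  show "a * b = b * a" by transfer (rule ext, rule zeon_comm_aux)
  show "1 * a = a"
  proof (rule zeon_eqI)
    fix I :: "nat set" assume "finite I" "0 \<notin> I"
    then show "zcoeff (1 * a) I = zcoeff a I"
    proof transfer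
      fix I :: "nat set" and a :: "nat set \<Rightarrow> complex"
      assume I: "finite I"
      have "(\<Sum>J\<in>Pow I. (if J = {} then 1 else 0) * a (I - J)) =
            (\<Sum>J\<in>Pow I. if J = {} then a I else 0)"
        by (rule sum.cong) auto
      also have "\<dots> = a I" using I by simp
      finally show "(\<Sum>J\<in>Pow I. (if J = {} then 1 else 0) * a (I - J)) = a I" .
    qed
  qed
  show "(a + b) * c = a * c + b * c" by transfer (simp add: distrib_right sum.distrib)
  show "(0::zeon) \<noteq> 1" by transfer (metis zero_neq_one)
qed

end

text \<open>The basis element \<open>\<zeta>\<^sub>I\<close>, for finite \<open>I\<close> not containing \<open>0\<close> (junk value \<open>0\<close> otherwise).\<close>

lift_definition zeta :: "nat set \<Rightarrow> zeon"
  is "\<lambda>I J. if J = I \<and> finite I \<and> 0 \<notin> I then 1 else 0"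
proof -
  fix I :: "nat set"
  have "{J. (if J = I \<and> finite I \<and> 0 \<notin> I then 1 else 0) \<noteq> (0::complex)} \<subseteq> {I}" by auto
  then show "finite {J. (if J = I \<and> finite I \<and> 0 \<notin> I then 1 else 0) \<noteq> (0::complex)} \<and>
    (\<forall>J. (if J = I \<and> finite I \<and> 0 \<notin> I then 1 else 0) \<noteq> (0::complex) \<longrightarrow> finite J \<and> 0 \<notin> J)"
    using finite_subset by (auto split: if_splits)
qed

lift_definition zscalar :: "complex \<Rightarrow> zeon" is "\<lambda>c I. if I = {} then c else 0" by simp

definition scalar_part :: "zeon \<Rightarrow> complex" where
  "scalar_part u = zcoeff u {}"

lift_definition zcnj :: "zeon \<Rightarrow> zeon" is "\<lambda>u I. cnj (u I)" by simp

subsection \<open>The defining relations and the basis\<close>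

lemma zcoeff_zscalar_mult: "zcoeff (zscalar c * u) I = c * zcoeff u I"
proof (cases "finite I")
  case True
  then show ?thesis
  proof transfer
    fix c and u :: "nat set \<Rightarrow> complex" and I :: "nat set"
    assume I: "finite I"
    have "(\<Sum>J\<in>Pow I. (if J = {} then c else 0) * u (I - J)) =
          (\<Sum>J\<in>Pow I. if J = {} then c * u I else 0)"
      by (rule sum.cong) auto
    also have "\<dots> = c * u I" using I by simp
    finally show "(\<Sum>J\<in>Pow I. (if J = {} then c else 0) * u (I - J)) = c * u I" .
  qed
next
  case False
  then show ?thesis using zcoeff_nonzeroD(1) by (metis mult_zero_right)
qed

lemma zscalar_add: "zscalar (a + b) = zscalar a + zscalar b"
  by (rule zeon_eqI) (simp add: zscalar.rep_eq plus_zeon.rep_eq)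

lemma zscalar_1: "zscalar 1 = 1"
  by (rule zeon_eqI) (simp add: zscalar.rep_eq one_zeon.rep_eq)

lemma zscalar_mult: "zscalar (a * b) = zscalar a * zscalar b"
proof (rule zeon_eqI)
  fix I
  show "zcoeff (zscalar (a * b)) I = zcoeff (zscalar a * zscalar b) I"
    by (simp add: zcoeff_zscalar_mult zscalar.rep_eq)
qed

lemma zeta_empty: "zeta {} = 1"
  by (rule zeon_eqI) (simp add: zeta.rep_eq one_zeon.rep_eq)

lemma zeta_mult:
  assumes "finite I" "finite J" "0 \<notin> I" "0 \<notin> J"
  shows "zeta I * zeta J = (if I \<inter> J = {} then zeta (I \<union> J) else 0)"
proof (rule zeon_eqI)
  fix L :: "nat set" assume L: "finite L" "0 \<notin> L"
  have "zcoeff (zeta I * zeta J) L =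
      (\<Sum>K\<in>Pow L. if K = I then (if L - I = J then 1 else 0) else 0)"
    unfolding times_zeon.rep_eq zeta.rep_eq using assms by (intro sum.cong) auto
  also have "\<dots> = (if I \<subseteq> L \<and> L - I = J then 1 else 0)"
    using L by auto
  also have "\<dots> = zcoeff (if I \<inter> J = {} then zeta (I \<union> J) else 0) L"
  proof (cases "I \<inter> J = {}")
    case True
    then have "(I \<subseteq> L \<and> L - I = J) \<longleftrightarrow> L = I \<union> J" by auto
    moreover have "zcoeff (zeta (I \<union> J)) L = (if L = I \<union> J then 1 else 0)"
      using assms by (simp add: zeta.rep_eq)
    ultimately show ?thesis using True by simp
  next
    case False
    then have "\<not> (I \<subseteq> L \<and> L - I = J)" by auto
    then show ?thesis using False by (simp add: zero_zeon.rep_eq)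
  qed
  finally show "zcoeff (zeta I * zeta J) L =
    zcoeff (if I \<inter> J = {} then zeta (I \<union> J) else 0) L" .
qed

lemma zeta_square: "i > 0 \<Longrightarrow> zeta {i} ^ 2 = 0"
  by (simp add: power2_eq_square zeta_mult)

lemma zeta_eq_prod: "finite I \<Longrightarrow> 0 \<notin> I \<Longrightarrow> zeta I = (\<Prod>i\<in>I. zeta {i})"
proof (induction I rule: finite_induct)
  case empty
  then show ?case by (simp add: zeta_empty)
next
  case (insert i I)
  then have "zeta (insert i I) = zeta {i} * zeta I" using zeta_mult[of "{i}" I] by auto
  also have "\<dots> = zeta {i} * (\<Prod>i\<in>I. zeta {i})" using insert by simp
  also have "\<dots> = (\<Prod>i\<in>insert i I. zeta {i})" using insert.hyps by simp
  finally show ?case .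
qed

lemma zcoeff_sum: "zcoeff (\<Sum>x\<in>X. u x) I = (\<Sum>x\<in>X. zcoeff (u x) I)"
  by (induction X rule: infinite_finite_induct) (auto simp: zero_zeon.rep_eq plus_zeon.rep_eq)

lemma zeon_expansion:
  "u = (\<Sum>I | zcoeff u I \<noteq> 0. zscalar (zcoeff u I) * zeta I)"
proof (rule zeon_eqI)
  fix L :: "nat set" assume L: "finite L" "0 \<notin> L"
  have "zcoeff (\<Sum>I | zcoeff u I \<noteq> 0. zscalar (zcoeff u I) * zeta I) L =
        (\<Sum>I | zcoeff u I \<noteq> 0. if I = L then zcoeff u L else 0)"
    unfolding zcoeff_sum zcoeff_zscalar_mult
    using L by (intro sum.cong) (auto simp: zeta.rep_eq)
  also have "\<dots> = zcoeff u L" by (simp add: finite_zcoeff_support)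
  finally show "zcoeff u L =
    zcoeff (\<Sum>I | zcoeff u I \<noteq> 0. zscalar (zcoeff u I) * zeta I) L" by simp
qed


section \<open>Spectrally simple eigenvalues\<close>

definition nonnull :: "zeon vec \<Rightarrow> bool" where
  "nonnull \<xi> \<longleftrightarrow> scalar_part (map_vec zcnj \<xi> \<bullet> \<xi>) \<noteq> 0"

text \<open>Not the eigenvalue notion of the library, which only asks for a nonzero eigenvector.\<close>

definition zeon_eigenvalue :: "zeon mat \<Rightarrow> zeon \<Rightarrow> bool" where
  "zeon_eigenvalue A lam \<longleftrightarrow>
     (\<exists>\<xi> \<in> carrier_vec (dim_row A). nonnull \<xi> \<and> A *\<^sub>v \<xi> = lam \<cdot>\<^sub>v \<xi>)"

text \<open>
  The library's root multiplicity \<open>order\<close> is restricted to integral domains, which the zeon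
  algebra is not; over a domain the two notions agree, see below.
\<close>

definition simple_zero :: "'a :: comm_ring_1 poly \<Rightarrow> 'a \<Rightarrow> bool" where
  "simple_zero p a \<longleftrightarrow> (\<exists>g. p = [:- a, 1:] * g \<and> poly g a \<noteq> 0)"

lemma simple_zero_iff_order:
  fixes p :: "'a :: idom poly"
  shows "simple_zero p a \<longleftrightarrow> p \<noteq> 0 \<and> order a p = 1"
proof
  assume "simple_zero p a"
  then obtain g where g: "p = [:- a, 1:] * g" "poly g a \<noteq> 0"
    unfolding simple_zero_def by blast
  then have "g \<noteq> 0" by auto
  then have "p \<noteq> 0" using g(1) by (simp only: mult_eq_0_iff) simp
  moreover have "order a p = order a [:- a, 1:] + order a g"
    using \<open>p \<noteq> 0\<close> g(1) order_mult by blast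
  moreover have "order a g = 0" using g(2) order_root by blast
  moreover have "order a [:- a, 1:] = 1" using order_power_n_n[of a 1] by simp
  ultimately show "p \<noteq> 0 \<and> order a p = 1" by simp
next
  assume p: "p \<noteq> 0 \<and> order a p = 1"
  then obtain g where "p = [:- a, 1:] ^ 1 * g" "\<not> [:- a, 1:] dvd g"
    using order_decomp[of p a] by auto
  then show "simple_zero p a"
    unfolding simple_zero_def by (auto simp: poly_eq_0_iff_dvd)
qed

definition spectrally_simple_eigenvalue :: "zeon mat \<Rightarrow> zeon \<Rightarrow> bool" where
  "spectrally_simple_eigenvalue A lam \<longleftrightarrow>
     zeon_eigenvalue A lam \<and>
     simple_zero (char_poly A) lam \<and>
     simple_zero (map_poly scalar_part (char_poly A)) (scalar_part lam)"


section \<open>Graphs and their labeled zeon Laplacians\<close>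

definition simple_graph :: "'v set \<Rightarrow> 'v set set \<Rightarrow> bool" where
  "simple_graph V E \<longleftrightarrow> finite V \<and> (\<forall>e\<in>E. e \<subseteq> V \<and> card e = 2)"

text \<open>
  Matrix indices start at \<open>0\<close>, whereas vertices, zeon generators and labels are numbered from
  \<open>1\<close>: row and column \<open>i\<close> belong to vertex \<open>v (Suc i)\<close>.
\<close>

definition nilpotent_adjacency :: "nat \<Rightarrow> (nat \<Rightarrow> 'v) \<Rightarrow> 'v set set \<Rightarrow> zeon mat" where
  "nilpotent_adjacency m v E =
     mat m m (\<lambda>(i, j). if {v (Suc i), v (Suc j)} \<in> E then zeta {Suc j} else 0)"

definition label_matrix :: "nat \<Rightarrow> (nat \<Rightarrow> nat) \<Rightarrow> zeon mat" where
  "label_matrix m f = mat_diag m (\<lambda>i. of_nat (f (Suc i)))"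

definition zeon_laplacian ::
    "nat \<Rightarrow> (nat \<Rightarrow> 'v) \<Rightarrow> 'v set set \<Rightarrow> (nat \<Rightarrow> nat) \<Rightarrow> zeon mat" where
  "zeon_laplacian m v E f = label_matrix m f - nilpotent_adjacency m v E"

text \<open>
  A cycle is the list \<open>w\<^sub>0, \<dots>, w\<^sub>k\<close> of its vertices, with \<open>k \<ge> 1\<close>; the one-element list is
  not a cycle. In a simple graph, adjacency then forces \<open>k \<ge> 2\<close>.
\<close>

definition based_cycle :: "'v set set \<Rightarrow> nat \<Rightarrow> 'v \<Rightarrow> 'v list \<Rightarrow> bool" where
  "based_cycle E k x w \<longleftrightarrow>
     k \<ge> 1 \<and> length w = Suc k \<and> w ! 0 = x \<and> w ! k = x \<and>
     (\<forall>i<k. {w ! i, w ! Suc i} \<in> E) \<and> distinct (take k w)"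

definition cycles_on :: "(nat \<Rightarrow> 'v) \<Rightarrow> 'v set set \<Rightarrow> nat \<Rightarrow> nat set \<Rightarrow> 'v list set" where
  "cycles_on v E l I = {w. \<exists>k. based_cycle E k (v l) w \<and> set (take k w) = v ` I}"

end

theory Submission
  imports Defs
begin

text \<open>
  Write \<open>d\<^sub>j = 1 / (f\<^sub>l - f\<^sub>j)\<close>. For each vertex \<open>i\<close> let
  \<open>\<theta>\<^sub>i = \<Sum>\<^sub>I N(i, I) (-1)\<^bsup>|I|\<^esup> (\<Prod>j\<in>I - {l}. d\<^sub>j) \<zeta>\<^sub>I\<close>, where \<open>N(i, I)\<close> counts the walks that
  start at \<open>i\<close>, then visit every vertex of \<open>I\<close> exactly once, and end at \<open>l\<close>. Splitting off the
  first step of a walk shows that the vector with \<open>\<xi>\<^sub>l = 1\<close> and \<open>\<xi>\<^sub>i = d\<^sub>i \<theta>\<^sub>i\<close> for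
  \<open>i \<noteq> l\<close> satisfies \<open>\<Sum>\<^sub>j \<psi>\<^sub>i\<^sub>j \<xi>\<^sub>j = - \<theta>\<^sub>i\<close>. All \<open>\<theta>\<^sub>i\<close> are multiples of \<open>\<zeta>\<^sub>l\<close>, so
  their products vanish, and \<open>\<xi>\<close> is an eigenvector for \<open>f\<^sub>l + \<theta>\<^sub>l\<close>. As it has a unit entry,
  Cramer's rule makes \<open>f\<^sub>l + \<theta>\<^sub>l\<close> a zero of the characteristic polynomial; its simplicity is
  inherited from the scalar part, the product of the \<open>t - f\<^sub>j\<close>.
\<close>

section \<open>Walks without repeated vertices\<close>

text \<open>The initial vertex \<open>i\<close> is not listed, and it may reappear in \<open>w\<close>; for \<open>i = l\<close> these are
  the cycles based at \<open>l\<close>.\<close>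

definition paths :: "('i \<Rightarrow> 'i \<Rightarrow> bool) \<Rightarrow> 'i \<Rightarrow> 'i \<Rightarrow> 'i set \<Rightarrow> 'i list set" where
  "paths A l i I =
     {w. w \<noteq> [] \<and> successively A (i # w) \<and> last w = l \<and> distinct w \<and> set w = I}"

lemma finite_paths: "finite I \<Longrightarrow> finite (paths A l i I)"
  by (rule finite_subset[OF _ finite_subset_distinct[of I]]) (auto simp: paths_def)

lemma paths_eq_empty: "l \<notin> I \<Longrightarrow> paths A l i I = {}"
  by (auto simp: paths_def)

text \<open>A walk is either the single step to \<open>l\<close> or a vertex \<open>j\<close>
  followed by a nonempty tail. The tail ends at \<open>l\<close>, so distinctness forces
  \<open>j\<close> \<noteq> \<open>l\<close>.\<close>

lemma paths_first_step:
  "paths A l i I = (if A i l \<and> I = {l} then {[l]} else {}) \<union>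
     (\<Union>j\<in>{j \<in> I - {l}. A i j}. Cons j ` paths A l j (I - {j}))" (is "_ = ?R")
proof
  show "paths A l i I \<subseteq> ?R"
  proof
    fix w assume w: "w \<in> paths A l i I"
    then obtain j u where ju: "w = j # u" by (cases w) (auto simp: paths_def)
    show "w \<in> ?R"
    proof (cases "u = []")
      case True
      then show ?thesis using w ju by (auto simp: paths_def)
    next
      case False
      then have "l \<in> set u" using w ju last_in_set[of u] by (auto simp: paths_def)
      then have "j \<in> {j \<in> I - {l}. A i j}" "u \<in> paths A l j (I - {j})"
        using w ju False by (auto simp: paths_def)
      then show ?thesis using ju by blast
    qed
  qed
  show "?R \<subseteq> paths A l i I"
  proof
    fix w assume "w \<in> ?R"
    then consider "A i l" "I = {l}" "w = [l]"
      | j u where "j \<in> I" "A i j" "w = j # u" "u \<in> paths A l j (I - {j})"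
      by (auto split: if_splits)
    then show "w \<in> paths A l i I"
    proof cases
      case 1
      then show ?thesis by (simp add: paths_def)
    next
      case 2
      then show ?thesis by (simp add: paths_def insert_absorb)
    qed
  qed
qed

lemma card_paths:
  assumes "finite I"
  shows "card (paths A l i I) = (if A i l \<and> I = {l} then 1 else 0) +
    (\<Sum>j | j \<in> I - {l} \<and> A i j. card (paths A l j (I - {j})))"
proof -
  let ?J = "{j \<in> I - {l}. A i j}"
  let ?U = "\<Union>j\<in>?J. Cons j ` paths A l j (I - {j})"
  let ?S = "if A i l \<and> I = {l} then {[l]} else {}"
  have J: "finite ?J" using assms by simp
  have fin: "finite (Cons j ` paths A l j (I - {j}))" for j
    using assms by (simp add: finite_paths)
  have "card ?U = (\<Sum>j\<in>?J. card (Cons j ` paths A l j (I - {j})))"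
    by (rule card_UN_disjoint) (use J fin in auto)
  also have "\<dots> = (\<Sum>j\<in>?J. card (paths A l j (I - {j})))"
    by (simp add: card_image)
  finally have U: "card ?U = (\<Sum>j\<in>?J. card (paths A l j (I - {j})))" .
  have "card (?S \<union> ?U) = card ?S + card ?U"
  proof (rule card_Un_disjoint)
    show "finite ?U" using J fin by blast
  qed auto
  then show ?thesis unfolding paths_first_step[of A l i I] U by simp
qed

text \<open>A list in \<open>paths\<close> omits the opening copy of the base vertex, whereas
  \<open>take k\<close> omits the closing one. Both leave the same vertices, and injectivity of
  \<open>v\<close> carries distinctness across.\<close>

lemma bij_betw_paths_cycles_on:
  assumes v: "inj_on v S" and I: "I \<subseteq> S" and l: "l \<in> S"
  shows "bij_betw (\<lambda>w. v l # map v w)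
    (paths (\<lambda>i j. {v i, v j} \<in> E) l l I) (cycles_on v E l I)"
  unfolding bij_betw_def
proof
  let ?P = "paths (\<lambda>i j. {v i, v j} \<in> E) l l I"
  have sub: "set w \<subseteq> S" if "w \<in> ?P" for w using that I by (auto simp: paths_def)
  show "inj_on (\<lambda>w. v l # map v w) ?P"
  proof (rule inj_onI)
    fix u w assume uw: "u \<in> ?P" "w \<in> ?P" and eq: "v l # map v u = v l # map v w"
    have "inj_on v (set u \<union> set w)"
      using inj_on_subset[OF v] sub[OF uw(1)] sub[OF uw(2)] by simp
    then show "u = w" using eq map_inj_on by simp
  qed
  show "(\<lambda>w. v l # map v w) ` ?P = cycles_on v E l I"
  proof
    show "(\<lambda>w. v l # map v w) ` ?P \<subseteq> cycles_on v E l I"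
    proof
      fix c assume "c \<in> (\<lambda>w. v l # map v w) ` ?P"
      then obtain w where w: "w \<in> ?P" and c: "c = v l # map v w" by blast
      obtain u where u: "w = u @ [l]"
        using w by (cases w rule: rev_cases) (auto simp: paths_def)
      have take: "take (length w) c = v l # map v u" using c u by simp
      have "inj_on v (set w)" using sub[OF w] v inj_on_subset by blast
      then have "distinct (map v w)" using w by (simp add: paths_def distinct_map)
      then have dist: "distinct (take (length w) c)" unfolding take using u by auto
      have set: "set (take (length w) c) = v ` I" unfolding take using w u
        by (auto simp: paths_def)
      have "successively (\<lambda>x y. {x, y} \<in> E) (map v (l # w))"
        unfolding successively_map using w by (simp add: paths_def)
      then have adj: "\<forall>i<length w. {c ! i, c ! Suc i} \<in> E"
        unfolding successively_conv_nth c by simp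
      have "based_cycle E (length w) (v l) c"
        unfolding based_cycle_def using dist adj c u by (auto simp: nth_append)
      then show "c \<in> cycles_on v E l I" using set unfolding cycles_on_def by blast
    qed
    show "cycles_on v E l I \<subseteq> (\<lambda>w. v l # map v w) ` ?P"
    proof
      fix c assume "c \<in> cycles_on v E l I"
      then obtain k where c: "based_cycle E k (v l) c" and set: "set (take k c) = v ` I"
        unfolding cycles_on_def by blast
      obtain u where u: "c = v l # u @ [v l]" and k: "k = Suc (length u)"
      proof -
        obtain x t where xt: "c = x # t" using c by (cases c) (auto simp: based_cycle_def)
        moreover have "t \<noteq> []" using c xt by (auto simp: based_cycle_def)
        then obtain u y where "t = u @ [y]" by (meson rev_exhaust)
        ultimately show thesis using that c by (auto simp: based_cycle_def nth_append)
      qed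
      have take: "take k c = v l # u" using u k by simp
      have "set u \<subseteq> v ` I" "v l \<in> v ` I" using set take by auto
      \<comment> \<open>The interior of the cycle is pulled back along \<open>v\<close> to a list of
        indices in \<open>I\<close>.\<close>
      then have "u \<in> map v ` lists I" "l \<in> I"
        using inj_on_image_mem_iff[OF v l I] by (auto simp: lists_image[symmetric])
      then obtain p where p: "set p \<subseteq> I" "u = map v p" and lI: "l \<in> I" by auto
      have "inj_on v I" using v I inj_on_subset by blast
      then have "set (l # p) = I"
        using set lI p inj_on_image_eq_iff[of v I "set (l # p)" I] by (simp add: take)
      moreover have "distinct (l # p)"
        using c unfolding based_cycle_def take p by (auto simp: distinct_map)
      moreover have "successively (\<lambda>x y. {x, y} \<in> E) (map v (l # p @ [l]))"
        using c unfolding successively_conv_nth based_cycle_def u k p by simp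
      ultimately have "p @ [l] \<in> ?P"
        unfolding successively_map by (auto simp: paths_def)
      then show "c \<in> (\<lambda>w. v l # map v w) ` ?P" using u p by (intro image_eqI[of _ _ "p @ [l]"]) simp_all
    qed
  qed
qed

section \<open>Zeon arithmetic\<close>

lemma zscalar_of_nat: "zscalar (of_nat n) = of_nat n"
proof (induction n)
  case 0
  show ?case by (rule zeon_eqI) (simp add: zscalar.rep_eq zero_zeon.rep_eq)
qed (simp add: zscalar_add zscalar_1)

lemma zcoeff_uminus: "zcoeff (- u) I = - zcoeff u I"
  by (simp add: uminus_zeon.rep_eq)

lemma zcoeff_zeta_mult:
  assumes "finite I" "0 < j"
  shows "zcoeff (zeta {j} * u) I = (if j \<in> I then zcoeff u (I - {j}) else 0)"
proof -
  have "zcoeff (zeta {j} * u) I = (\<Sum>J\<in>Pow I. if J = {j} then zcoeff u (I - {j}) else 0)"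
    unfolding times_zeon.rep_eq zeta.rep_eq using assms by (intro sum.cong) auto
  then show ?thesis using assms by simp
qed

lemma zcoeff_sum_zeta:
  assumes "finite S" "0 \<notin> S"
  shows "zcoeff (\<Sum>I\<in>Pow S. zscalar (c I) * zeta I) J = (if J \<subseteq> S then c J else 0)"
proof -
  have "zcoeff (\<Sum>I\<in>Pow S. zscalar (c I) * zeta I) J = (\<Sum>I\<in>Pow S. if I = J then c J else 0)"
    unfolding zcoeff_sum zcoeff_zscalar_mult
    by (intro sum.cong) (use assms finite_subset in \<open>auto simp: zeta.rep_eq\<close>)
  then show ?thesis using assms by simp
qed

text \<open>Both factors are multiples of \<open>\<zeta>\<^sub>l\<close>.\<close>

lemma zeon_mult_eq_0:
  assumes "\<And>I. l \<notin> I \<Longrightarrow> zcoeff u I = 0" "\<And>I. l \<notin> I \<Longrightarrow> zcoeff w I = 0"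
  shows "u * w = 0"
proof (rule zeon_eqI)
  fix I
  have "zcoeff u J * zcoeff w (I - J) = 0" for J
    using assms by (cases "l \<in> J") auto
  then show "zcoeff (u * w) I = zcoeff 0 I" by (simp add: times_zeon.rep_eq zero_zeon.rep_eq del: mult_eq_0_iff)
qed

text \<open>Multiplicative because the empty set splits only into two empty sets. This gives access
  to the transfer of characteristic polynomials along ring homomorphisms.\<close>

interpretation scalar_part: comm_ring_hom scalar_part
  by unfold_locales
    (simp_all add: scalar_part_def one_zeon.rep_eq zero_zeon.rep_eq plus_zeon.rep_eq
      times_zeon.rep_eq)

lemma scalar_part_zscalar: "scalar_part (zscalar c) = c"
  by (simp add: scalar_part_def zscalar.rep_eq)

section \<open>Spectrally simple eigenvalues\<close>

text \<open>In the presence of zero divisors, a nonzero kernel vector of \<open>M\<close> does not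
  force \<open>det M\<close> = 0. The adjugate gives \<open>det M\<close> times \<open>x\<close> =
  0, and the entry 1 of \<open>x\<close> isolates \<open>det M\<close>.\<close>

lemma char_poly_root_if_unit_entry:
  fixes A :: "'a :: comm_ring_1 mat"
  assumes A: "A \<in> carrier_mat n n" and x: "x \<in> carrier_vec n"
    and ev: "A *\<^sub>v x = a \<cdot>\<^sub>v x" and l: "l < n" "x $ l = 1"
  shows "poly (char_poly A) a = 0"
proof -
  define M where "M = map_mat (\<lambda>p. poly p a) (char_poly_matrix A)"
  have M: "M \<in> carrier_mat n n" using A by (simp add: M_def)
  have det: "poly (char_poly A) a = det M"
    unfolding char_poly_def by (rule poly_det_cong[OF M]) (use A in \<open>auto simp: M_def char_poly_matrix_def\<close>)
  have "M *\<^sub>v x = 0\<^sub>v n"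
  proof (rule eq_vecI)
    fix i assume "i < dim_vec (0\<^sub>v n :: 'a vec)"
    then have i: "i < n" by simp
    have Mij: "M $$ (i, j) = (if i = j then a else 0) - A $$ (i, j)" if "j < n" for j
      using A i that by (auto simp: M_def char_poly_matrix_def)
    have "(A *\<^sub>v x) $ i = a * x $ i" using ev x i by simp
    then have "(\<Sum>j = 0..<n. A $$ (i, j) * x $ j) = a * x $ i"
      using A x i by (simp add: scalar_prod_def)
    moreover have "(\<Sum>j = 0..<n. (if i = j then a else 0) * x $ j) = a * x $ i"
      using i by (simp add: if_distrib[of "\<lambda>y. y * _"] cong: if_cong)
    ultimately show "(M *\<^sub>v x) $ i = 0\<^sub>v n $ i"
      using M x i by (simp add: scalar_prod_def Mij left_diff_distrib sum_subtractf)
  qed (use M in auto)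
  then have "adj_mat M *\<^sub>v (M *\<^sub>v x) = 0\<^sub>v n"
    using adj_mat(1)[OF M] by (auto intro!: eq_vecI)
  moreover have "adj_mat M *\<^sub>v (M *\<^sub>v x) = (adj_mat M * M) *\<^sub>v x"
    using adj_mat(1)[OF M] M x by simp
  ultimately have "(det M \<cdot>\<^sub>m 1\<^sub>m n) *\<^sub>v x = 0\<^sub>v n" by (simp add: adj_mat(3)[OF M])
  then have "((det M \<cdot>\<^sub>m 1\<^sub>m n) *\<^sub>v x) $ l = 0" using l by simp
  moreover have "((det M \<cdot>\<^sub>m 1\<^sub>m n) *\<^sub>v x) $ l = det M * x $ l"
  proof -
    have "((det M \<cdot>\<^sub>m 1\<^sub>m n) *\<^sub>v x) $ l =
        (\<Sum>i = 0..<n. det M * (if i = l then 1 else 0) * x $ i)"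
      using l(1) x by (simp add: scalar_prod_def)
    also have "\<dots> = (\<Sum>i = 0..<n. if i = l then det M * x $ l else 0)"
      by (rule sum.cong) auto
    finally show ?thesis using l(1) by simp
  qed
  ultimately show ?thesis using det l by simp
qed

text \<open>The root splits off a linear factor. The value of the cofactor at \<open>a\<close> is
  nonzero as soon as its scalar part is, and that is the value of the complex cofactor.\<close>

lemma simple_zero_if_scalar_part:
  assumes root: "poly p a = 0"
    and sp: "simple_zero (map_poly scalar_part p) (scalar_part a)"
  shows "simple_zero p a"
proof -
  interpret map_poly_comm_ring_hom scalar_part ..
  obtain g where g: "p = [:- a, 1:] * g"
    using root by (auto simp: poly_eq_0_iff_dvd)
  obtain h where h: "map_poly scalar_part p = [:- scalar_part a, 1:] * h"
    "poly h (scalar_part a) \<noteq> 0"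
    using sp by (auto simp: simple_zero_def)
  have "map_poly scalar_part p = [:- scalar_part a, 1:] * map_poly scalar_part g"
    by (simp only: g hom_mult) (simp add: scalar_part.hom_uminus)
  \<comment> \<open>The linear factor is cancelled among complex polynomials, an integral
    domain.\<close>
  then have "map_poly scalar_part g = h"
    using h(1) by (metis mult_left_cancel pCons_eq_0_iff zero_neq_one)
  then have "scalar_part (poly g a) \<noteq> 0" using h(2) by auto
  then have "poly g a \<noteq> 0" by auto
  then show ?thesis using g unfolding simple_zero_def by blast
qed

lemma simple_zero_prod_linear:
  fixes c :: "'i \<Rightarrow> 'a :: idom"
  assumes "finite S" "inj_on c S" "l \<in> S"
  shows "simple_zero (\<Prod>i\<in>S. [:- c i, 1:]) (c l)"
proof -
  have "(\<Prod>i\<in>S. [:- c i, 1:]) = [:- c l, 1:] * (\<Prod>i\<in>S - {l}. [:- c i, 1:])"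
    using assms by (simp add: prod.remove)
  moreover have "poly (\<Prod>i\<in>S - {l}. [:- c i, 1:]) (c l) \<noteq> 0"
    using assms by (auto simp: poly_prod inj_on_def)
  ultimately show ?thesis unfolding simple_zero_def by blast
qed

section \<open>The labeled zeon Laplacian\<close>

lemma zeon_laplacian_carrier: "zeon_laplacian m v E f \<in> carrier_mat m m"
  unfolding zeon_laplacian_def nilpotent_adjacency_def by (rule minus_carrier_mat) simp

text \<open>The generators have scalar part 0, so only the diagonal matrix of labels
  survives.\<close>

lemma map_poly_scalar_part_char_poly_laplacian:
  "map_poly scalar_part (char_poly (zeon_laplacian m v E f)) = (\<Prod>i\<in>{1..m}. [:- of_nat (f i), 1:])"
proof -
  let ?D = "mat_diag m (\<lambda>i. of_nat (f (Suc i))) :: complex mat"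
  have "map_mat scalar_part (zeon_laplacian m v E f) = ?D"
  proof (rule eq_matI)
    fix i j assume "i < dim_row ?D" "j < dim_col ?D"
    then have "i < m" "j < m" by (simp_all add: mat_diag_def)
    moreover have "scalar_part (of_nat n) = of_nat n" for n
      by (metis scalar_part_zscalar zscalar_of_nat)
    moreover have "scalar_part (zeta {Suc n}) = 0" for n
      by (simp add: scalar_part_def zeta.rep_eq)
    ultimately show "map_mat scalar_part (zeon_laplacian m v E f) $$ (i, j) = ?D $$ (i, j)"
      by (simp add: zeon_laplacian_def label_matrix_def nilpotent_adjacency_def mat_diag_def
        scalar_part.hom_minus)
  qed (use zeon_laplacian_carrier[of m v E f] in \<open>simp_all add: mat_diag_def\<close>)
  then have "map_poly scalar_part (char_poly (zeon_laplacian m v E f)) = char_poly ?D"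
    using scalar_part.char_poly_hom[OF zeon_laplacian_carrier] by metis
  also have "\<dots> = (\<Prod>a\<leftarrow>diag_mat ?D. [:- a, 1:])"
    by (rule char_poly_upper_triangular[of _ m]) (auto simp: mat_diag_def)
  also have "\<dots> = (\<Prod>i\<in>{0..<m}. [:- of_nat (f (Suc i)), 1:])"
    by (simp add: diag_mat_def mat_diag_def prod.list_conv_set_nth)
  also have "\<dots> = (\<Prod>i\<in>{1..m}. [:- of_nat (f i), 1:])"
    by (rule prod.reindex_bij_witness[of _ "\<lambda>i. i - 1" Suc]) auto
  finally show ?thesis .
qed

lemma zeon_laplacian_mult_vec:
  assumes "i < m"
  shows "(zeon_laplacian m v E f *\<^sub>v vec m (\<lambda>i. x (Suc i))) $ i =
    of_nat (f (Suc i)) * x (Suc i) -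
    (\<Sum>j | j \<in> {1..m} \<and> {v (Suc i), v j} \<in> E. zeta {j} * x j)"
proof -
  have "(zeon_laplacian m v E f *\<^sub>v vec m (\<lambda>i. x (Suc i))) $ i =
      (\<Sum>j = 0..<m. (if i = j then of_nat (f (Suc i)) * x (Suc i) else 0) -
        (if {v (Suc i), v (Suc j)} \<in> E then zeta {Suc j} * x (Suc j) else 0))"
    using assms by (auto simp: zeon_laplacian_def label_matrix_def nilpotent_adjacency_def
      mat_diag_def scalar_prod_def left_diff_distrib intro!: sum.cong)
  also have "\<dots> = of_nat (f (Suc i)) * x (Suc i) -
      (\<Sum>j = 0..<m. if {v (Suc i), v (Suc j)} \<in> E then zeta {Suc j} * x (Suc j) else 0)"
    using assms by (simp add: sum_subtractf)
  also have "(\<Sum>j = 0..<m. if {v (Suc i), v (Suc j)} \<in> E then zeta {Suc j} * x (Suc j) else 0) =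
      (\<Sum>j\<in>{1..m}. if {v (Suc i), v j} \<in> E then zeta {j} * x j else 0)"
    by (rule sum.reindex_bij_witness[of _ "\<lambda>i. i - 1" Suc]) auto
  also have "\<dots> = (\<Sum>j | j \<in> {1..m} \<and> {v (Suc i), v j} \<in> E. zeta {j} * x j)"
    by (simp only: sum.inter_filter[OF finite_atLeastAtMost])
  finally show ?thesis .
qed

section \<open>Weighted walk sums and their recursion\<close>

definition path_sum ::
    "nat set \<Rightarrow> (nat \<Rightarrow> nat \<Rightarrow> bool) \<Rightarrow> (nat \<Rightarrow> complex) \<Rightarrow> nat \<Rightarrow> nat \<Rightarrow> zeon" where
  "path_sum S A d l i = (\<Sum>I\<in>Pow S. zscalar
     (of_int ((-1) ^ card I * int (card (paths A l i I))) * (\<Prod>j\<in>I - {l}. d j)) * zeta I)"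

lemma zcoeff_path_sum:
  assumes "finite S" "0 \<notin> S"
  shows "zcoeff (path_sum S A d l i) I = (if I \<subseteq> S
    then of_int ((-1) ^ card I * int (card (paths A l i I))) * (\<Prod>j\<in>I - {l}. d j) else 0)"
  unfolding path_sum_def by (rule zcoeff_sum_zeta[OF assms])

lemma path_sum_mult:
  assumes "finite S" "0 \<notin> S"
  shows "path_sum S A d l i * path_sum S A d l j = 0"
  by (rule zeon_mult_eq_0[of l]) (simp_all add: zcoeff_path_sum[OF assms] paths_eq_empty)

text \<open>This is the recursion \<open>card_paths\<close> read off at each coefficient:
  multiplying by \<open>zeta {j}\<close> prepends \<open>j\<close> to a walk, \<open>d j\<close>
  supplies its weight, and the entry 1 at \<open>l\<close> accounts for the one-step walk.\<close>

lemma path_sum_first_step: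
  fixes A :: "nat \<Rightarrow> nat \<Rightarrow> bool" and d :: "nat \<Rightarrow> complex"
  assumes S: "finite S" "0 \<notin> S" and l: "l \<in> S"
  defines "\<xi> \<equiv> \<lambda>j. if j = l then 1 else zscalar (d j) * path_sum S A d l j"
  shows "(\<Sum>j | j \<in> S \<and> A i j. zeta {j} * \<xi> j) = - path_sum S A d l i"
proof (rule zeon_eqI)
  fix I :: "nat set" assume I: "finite I" "0 \<notin> I"
  define K :: "nat set \<Rightarrow> complex" where "K I = (-1) ^ card I * (\<Prod>j\<in>I - {l}. d j)" for I
  let ?N = "\<lambda>j I. of_nat (card (paths A l j I)) :: complex"
  have pos: "0 < j" if "j \<in> S" for j using S that by (metis gr0I)
  have \<theta>: "zcoeff (path_sum S A d l j) J = (if J \<subseteq> S then ?N j J * K J else 0)" for j J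
    by (simp add: zcoeff_path_sum[OF S] K_def)
  \<comment> \<open>Removing \<open>j\<close> from \<open>I\<close> costs one sign and the factor
    \<open>d j\<close>; this is the source of the minus sign in the conclusion.\<close>
  have K_step: "K I = - d j * K (I - {j})" if "j \<in> I - {l}" for j
  proof -
    have "card I = Suc (card (I - {j}))"
      using that I by (metis DiffD1 card_Suc_Diff1)
    moreover have "(\<Prod>i\<in>I - {l}. d i) = d j * (\<Prod>i\<in>I - {l} - {j}. d i)"
      using that I by (simp add: prod.remove)
    moreover have "I - {l} - {j} = I - {j} - {l}" by auto
    ultimately show ?thesis by (simp add: K_def)
  qed
  have term_l: "zcoeff (zeta {l} * \<xi> l) I = (if I = {l} then 1 else 0)"
    using pos[OF l] I by (auto simp: \<xi>_def zeta.rep_eq)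
  have term_j: "zcoeff (zeta {j} * \<xi> j) I =
      (if j \<in> I \<and> I \<subseteq> S then - ?N j (I - {j}) * K I else 0)" if "j \<in> S - {l}" for j
  proof (cases "j \<in> I")
    case True
    then have "I - {j} \<subseteq> S \<longleftrightarrow> I \<subseteq> S" and "K I = - d j * K (I - {j})"
      using that K_step[of j] by auto
    then show ?thesis
      using that True pos[of j] I
      by (simp add: zcoeff_zeta_mult \<xi>_def zcoeff_zscalar_mult \<theta> mult.left_commute)
  qed (use that pos[of j] I in \<open>simp add: zcoeff_zeta_mult\<close>)
  have "zcoeff (\<Sum>j | j \<in> S \<and> A i j. zeta {j} * \<xi> j) I =
      (\<Sum>j | j \<in> S \<and> A i j. zcoeff (zeta {j} * \<xi> j) I)"
    by (simp add: zcoeff_sum)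
  also have "\<dots> = (if A i l then zcoeff (zeta {l} * \<xi> l) I else 0) +
      (\<Sum>j | j \<in> S - {l} \<and> A i j. zcoeff (zeta {j} * \<xi> j) I)"
  proof (cases "A i l")
    case True
    have "{j. j \<in> S \<and> A i j} = insert l {j. j \<in> S - {l} \<and> A i j}" using True l by auto
    then show ?thesis using True S by simp
  next
    case False
    then have "{j. j \<in> S \<and> A i j} = {j. j \<in> S - {l} \<and> A i j}" by auto
    then show ?thesis using False by simp
  qed
  also have "\<dots> = (if A i l \<and> I = {l} then 1 else 0) +
      (\<Sum>j | j \<in> S - {l} \<and> A i j. if j \<in> I \<and> I \<subseteq> S then - ?N j (I - {j}) * K I else 0)"
    using term_l term_j by (auto intro!: sum.cong)
  also have "\<dots> = zcoeff (- path_sum S A d l i) I"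
  proof (cases "I \<subseteq> S")
    case True
    have "(\<Sum>j | j \<in> S - {l} \<and> A i j. if j \<in> I \<and> I \<subseteq> S then - ?N j (I - {j}) * K I else 0) =
        (\<Sum>j | j \<in> I - {l} \<and> A i j. - ?N j (I - {j}) * K I)"
      by (rule sum.mono_neutral_cong_right) (use S True in auto)
    also have "\<dots> = - (\<Sum>j | j \<in> I - {l} \<and> A i j. ?N j (I - {j})) * K I"
      by (simp add: sum_distrib_right sum_negf)
    \<comment> \<open>For \<open>I = {l}\<close> the product in \<open>K\<close> is empty and
      \<open>K I\<close> = -1, which matches the one-step walk.\<close>
    finally show ?thesis
      using True by (auto simp: zcoeff_uminus \<theta> card_paths[OF I(1)] algebra_simps K_def)
  next
    case False
    then show ?thesis using l by (auto simp: zcoeff_uminus \<theta>)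
  qed
  finally show "zcoeff (\<Sum>j | j \<in> S \<and> A i j. zeta {j} * \<xi> j) I =
    zcoeff (- path_sum S A d l i) I" .
qed

section \<open>The eigenvector and spectral simplicity\<close>

lemma laplacian_spectrally_simple:
  fixes v :: "nat \<Rightarrow> 'v" and E :: "'v set set" and f :: "nat \<Rightarrow> nat"
  assumes inj: "inj_on f {1..m}" and l: "l \<in> {1..m}"
  defines "\<theta> \<equiv> path_sum {1..m} (\<lambda>i j. {v i, v j} \<in> E)
    (\<lambda>j. inverse (of_nat (f l) - of_nat (f j))) l"
  shows "spectrally_simple_eigenvalue (zeon_laplacian m v E f) (zscalar (of_nat (f l)) + \<theta> l)"
proof -
  let ?d = "\<lambda>j. inverse (of_nat (f l) - of_nat (f j)) :: complex"
  let ?L = "zeon_laplacian m v E f"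
  let ?lam = "zscalar (of_nat (f l)) + \<theta> l"
  define \<xi> where "\<xi> j = (if j = l then 1 else zscalar (?d j) * \<theta> j)" for j
  define x where "x = vec m (\<lambda>i. \<xi> (Suc i))"
  have S: "finite {1..m}" "0 \<notin> {1..m}" by auto
  have x: "x \<in> carrier_vec m" by (simp add: x_def)
  have sp_\<theta>: "scalar_part (\<theta> j) = 0" for j
    unfolding \<theta>_def scalar_part_def zcoeff_path_sum[OF S] by (simp add: paths_eq_empty)
  have sp_\<xi>: "scalar_part (\<xi> j) = (if j = l then 1 else 0)" for j
    by (simp add: \<xi>_def scalar_part.hom_mult sp_\<theta>)
  have step: "(\<Sum>j | j \<in> {1..m} \<and> {v i, v j} \<in> E. zeta {j} * \<xi> j) = - \<theta> i" for i
    unfolding \<xi>_def \<theta>_def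
    by (rule path_sum_first_step[OF S l])
  have eigen: "?L *\<^sub>v x = ?lam \<cdot>\<^sub>v x"
  proof (rule eq_vecI)
    fix i assume "i < dim_vec (?lam \<cdot>\<^sub>v x)"
    then have i: "i < m" by (simp add: x_def)
    let ?j = "Suc i"
    have "(?L *\<^sub>v x) $ i = zscalar (of_nat (f ?j)) * \<xi> ?j + \<theta> ?j"
      unfolding x_def zeon_laplacian_mult_vec[OF i] step by (simp add: zscalar_of_nat)
    also have "\<dots> = ?lam * \<xi> ?j"
    proof (cases "?j = l")
      case True
      then show ?thesis by (simp add: \<xi>_def)
    next
      case False
      then have "f ?j \<noteq> f l" using inj_on_eq_iff[OF inj, of ?j l] l i by simp
      \<comment> \<open>This equation dictates the choice of \<open>?d\<close>: it makes row
        \<open>?j\<close> balance up to the term with \<open>\<theta> l\<close>.\<close>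
      then have "of_nat (f l) * ?d ?j = of_nat (f ?j) * ?d ?j + 1"
        by (simp add: field_simps)
      then have "zscalar (of_nat (f l)) * zscalar (?d ?j) =
          zscalar (of_nat (f ?j)) * zscalar (?d ?j) + 1"
        by (metis zscalar_1 zscalar_add zscalar_mult)
      then have "zscalar (of_nat (f l)) * \<xi> ?j = zscalar (of_nat (f ?j)) * \<xi> ?j + \<theta> ?j"
        using False by (simp add: \<xi>_def mult.assoc[symmetric] distrib_right)
      \<comment> \<open>Both factors are multiples of \<open>zeta {l}\<close>.\<close>
      moreover have "\<theta> l * \<xi> ?j = 0"
        using False path_sum_mult[OF S] by (simp add: \<xi>_def \<theta>_def mult.left_commute)
      ultimately show ?thesis by (simp add: distrib_right)
    qed
    finally show "(?L *\<^sub>v x) $ i = (?lam \<cdot>\<^sub>v x) $ i" using i by (simp add: x_def)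
  qed (use zeon_laplacian_carrier[of m v E f] in \<open>simp add: x_def\<close>)
  have "nonnull x"
  proof -
    have cnj: "scalar_part (zcnj u) = cnj (scalar_part u)" for u
      by (simp add: scalar_part_def zcnj.rep_eq)
    \<comment> \<open>The scalar part of \<open>x\<close> is a standard unit vector; vertex
      \<open>l\<close> sits at the zero-based position \<open>l - 1\<close>.\<close>
    have "scalar_part (map_vec zcnj x \<bullet> x) =
        (\<Sum>i = 0..<m. if i = l - 1 then 1 else 0)"
      unfolding scalar_prod_def scalar_part.hom_sum
      by (rule sum.cong) (use l in \<open>auto simp: x_def scalar_part.hom_mult cnj sp_\<xi>\<close>)
    also have "\<dots> = 1" using l by auto
    finally show ?thesis by (simp add: nonnull_def)
  qed
  then have eigenvalue: "zeon_eigenvalue ?L ?lam"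
    unfolding zeon_eigenvalue_def carrier_matD(1)[OF zeon_laplacian_carrier]
    using x eigen by blast
  have sp_lam: "scalar_part ?lam = of_nat (f l)"
    by (simp add: scalar_part.hom_add scalar_part_zscalar sp_\<theta>)
  \<comment> \<open>Distinct labels make all roots of the scalar characteristic polynomial
    simple.\<close>
  have "inj_on (\<lambda>i. of_nat (f i) :: complex) {1..m}"
    by (rule inj_onI) (metis inj inj_onD of_nat_eq_iff)
  then have sp: "simple_zero (map_poly scalar_part (char_poly ?L)) (scalar_part ?lam)"
    unfolding map_poly_scalar_part_char_poly_laplacian sp_lam
    by (rule simple_zero_prod_linear[OF S(1) _ l])
  have "poly (char_poly ?L) ?lam = 0"
    by (rule char_poly_root_if_unit_entry[OF zeon_laplacian_carrier x eigen, of "l - 1"])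
      (use l in \<open>auto simp: x_def \<xi>_def\<close>)
  then show ?thesis
    unfolding spectrally_simple_eigenvalue_def
    using eigenvalue sp simple_zero_if_scalar_part[OF _ sp] by simp
qed

theorem corollary4p1:
  fixes V :: "'v set" and E :: "'v set set" and m :: nat
    and v :: "nat \<Rightarrow> 'v" and f :: "nat \<Rightarrow> nat"
  assumes "simple_graph V E"
    and "bij_betw v {1..m} V"
    and "\<forall>i\<in>{1..m}. 0 < f i"
    and "inj_on f {1..m}"
  shows "\<forall>l\<in>{1..m}. \<exists>(lam :: zeon) (\<omega> :: nat set \<Rightarrow> int).
    spectrally_simple_eigenvalue (zeon_laplacian m v E f) lam \<and>
    (\<forall>I\<in>Pow {1..m}. (-1) ^ card I * \<omega> I = int (card (cycles_on v E l I))) \<and>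
    lam = zscalar (of_nat (f l)) +
      (\<Sum>I\<in>Pow {1..m}.
        zscalar (of_int (\<omega> I) *
          (\<Prod>j\<in>I - {l}. inverse (of_nat (f l) - of_nat (f j)))) * zeta I)"
proof
  fix l assume l: "l \<in> {1..m}"
  let ?A = "\<lambda>i j. {v i, v j} \<in> E"
  let ?d = "\<lambda>j. inverse (of_nat (f l) - of_nat (f j)) :: complex"
  \<comment> \<open>The sign is its own inverse, so multiplying by it again leaves the bare
    count.\<close>
  define \<omega> where "\<omega> I = (-1) ^ card I * int (card (paths ?A l l I))" for I
  have count: "(-1) ^ card I * \<omega> I = int (card (cycles_on v E l I))" if "I \<in> Pow {1..m}" for I
  proof -
    have "card (paths ?A l l I) = card (cycles_on v E l I)"
      using bij_betw_paths_cycles_on[of v "{1..m}" I l E] assms(2) l that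
      by (auto simp: bij_betw_def intro: bij_betw_same_card)
    then show ?thesis by (simp add: \<omega>_def mult.assoc[symmetric] power_add[symmetric])
  qed
  have "spectrally_simple_eigenvalue (zeon_laplacian m v E f)
      (zscalar (of_nat (f l)) + path_sum {1..m} ?A ?d l l)"
    by (rule laplacian_spectrally_simple[OF assms(4) l])
  then show "\<exists>(lam :: zeon) (\<omega> :: nat set \<Rightarrow> int).
    spectrally_simple_eigenvalue (zeon_laplacian m v E f) lam \<and>
    (\<forall>I\<in>Pow {1..m}. (-1) ^ card I * \<omega> I = int (card (cycles_on v E l I))) \<and>
    lam = zscalar (of_nat (f l)) +
      (\<Sum>I\<in>Pow {1..m}.
        zscalar (of_int (\<omega> I) *
          (\<Prod>j\<in>I - {l}. inverse (of_nat (f l) - of_nat (f j)))) * zeta I)"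
    using count unfolding path_sum_def \<omega>_def[symmetric] by blast
qed

end
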